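(* Work in CCSK$^{\mathrm{P}}$ as described in the context. (i) Let $t_1 : X_1 \xrightarrow{\theta_1} X_1'$ and $t_2 : X_2 \xrightarrow{\theta_2} X_2'$ be combined (forward or backward) transitions such that $t_1$ and $t_2$ are connected, and suppose $X_1$ is reachable. Then $\theta_1 \bowtie \theta_2$. (ii) Let $\theta_1,\theta_2$ be proof keyed labels with $\theta_1 \bowtie \theta_2$. Then there exist combined transitions $t_1 : X_1 \xrightarrow{\theta_1} X_1'$ and $t_2 : X_2 \xrightarrow{\theta_2} X_2'$ such that $X_1$ is reachable and $t_1$ and $t_2$ are connected.
   Context: Syntax. $\mathsf N$ is an infinite set of names ($a,b,c$), with a bijection $a\mapsto\overline a$ onto a disjoint set $\overline{\mathsf N}$ of co-names (with $\overline{\overline a}=a$). Labels: $\mathsf L=\mathsf N\cup\overline{\mathsf N}\cup\{\tau\}$, ranged over by $\alpha$; $\lambda$ ranges over $\mathsf L\setminus\{\tau\}$. $\mathsf K$ is a denumerable set of keys ($k,m,n$) with decidable equality. Processes: $X,Y ::= \mathbf 0 \mid \alpha.X \mid \alpha[k].X \mid X+Y \mid X\mid Y \mid X\setminus a$ (with $a\in\mathsf N$); $X\setminus a$ binds $a$ in $X$ and $\alpha$-equivalent processes are identified. $\mathrm{keys}(X)$ is the set of keys occurring in $X$; $X$ is standard, $\mathrm{std}(X)$, iff $\mathrm{keys}(X)=\emptyset$. Proof keyed labels: $\theta ::= v\,\alpha[k] \mid v\,\langle \theta_L,\theta_R\rangle$ where $v,v_1,v_2$ are finite strings over the symbols $\{|_L,|_R,+_L,+_R\}$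 and in a synchronisation label $\theta_L=v_1\lambda[k]$, $\theta_R=v_2\overline\lambda[k]$ (same key $k$; informally written $\langle |_L v_1\lambda[k], |_R v_2\overline\lambda[k]\rangle$). Writing $s\theta$ for prefixing symbol $s$ to $\theta$: $\ell(v\alpha[k])=\alpha$, $\ell(v\langle\theta_L,\theta_R\rangle)=\tau$, $\mathrm{key}(v\alpha[k])=k$, $\mathrm{key}(v\langle v_1\lambda[k],v_2\overline\lambda[k]\rangle)=k$. Forward rules ($\to_f$): (pref) $\alpha.X\xrightarrow{\alpha[k]}_f\alpha[k].X$ if $\mathrm{std}(X)$; (kpref) if $X\xrightarrow{\theta}_f X'$ and $\mathrm{key}(\theta)\neq k$ then $\alpha[k].X\xrightarrow{\theta}_f\alpha[k].X'$; ($+_L$) if $X\xrightarrow{\theta}_f X'$ and $\mathrm{std}(Y)$ then $X+Y\xrightarrow{+_L\theta}_f X'+Y$; ($+_R$) if $Y\xrightarrow{\theta}_f Y'$ and $\mathrm{std}(X)$ then $X+Y\xrightarrow{+_R\theta}_f X+Y'$; ($|_L$) if $X\xrightarrow{\theta}_f X'$ and $\mathrm{key}(\theta)\notin\mathrm{keys}(Y)$ then $X\mid Y\xrightarrow{|_L\theta}_f X'\mid Y$; ($|_R$) symmetrically with label $|_R\theta$; (syn) if $X\xrightarrow{v_1\lambda[k]}_f X'$ and $Y\xrightarrow{v_2\overline\lambda[k]}_f Y'$ then $X\mid Y\xrightarrow{\langle v_1\lambda[k],v_2\overline\lambda[k]\rangle}_f X'\mid Y'$; (nu) if $X\xrightarrow{\theta}_f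 X'$ and $\ell(\theta)\notin\{a,\overline a\}$ then $X\setminus a\xrightarrow{\theta}_f X'\setminus a$. Backward rules ($\to_b$) are the mirror images: each forward rule with every transition reversed (e.g. $\alpha[k].X\xrightarrow{\alpha[k]}_b\alpha.X$ if $\mathrm{std}(X)$; if $X'\xrightarrow{\theta}_b X$ and $\mathrm{std}(Y)$ then $X'+Y\xrightarrow{+_L\theta}_b X+Y$; etc.), with the same side conditions. A combined transition $X\xrightarrow{\theta}Y$ is a forward or a backward one; $X$ is its source, $Y$ its target. A path is a finite, possibly empty, sequence of consecutive combined transitions (reflexive–transitive closure). $X$ is reachable if there is a path from some standard process to $X$. Two transitions $t_1: X_1\xrightarrow{\theta_1}X_1'$, $t_2: X_2\xrightarrow{\theta_2}X_2'$ are connected if there is a path from $X_1$ to $X_2$. Connectivity $\bowtie$ on proof labels is the least relation closed under the rules (for $D\in\{L,R\}$, $\overline L=R$, $\overline R=L$; $\alpha[k]$ denotes a label with empty string $v$): (A$^1$) $\alpha[k]\bowtie\theta$; (A$^2$) $\theta\bowtie\alpha[k]$; (P$^1_D$) $\theta_1\bowtie\theta_2\Rightarrow |_D\theta_1\bowtie|_D\theta_2$; (P$^2_D$) $|_D\theta_1\bowtie|_{\overline D}\theta_2$; (C$^1_D$) $\theta_1\bowtie\theta_2\Rightarrow +_D\theta_1\bowtie+_D\theta_2$; (C$^2_D$) $+_D\theta_1\bowtie+_{\overline D}\theta_2$; (S$^1_D$) $\theta\bowtie\theta_D\Rightarrow |_D\theta\bowtie\langle\theta_L,\theta_R\rangle$;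 (S$^2_D$) $\theta_D\bowtie\theta\Rightarrow\langle\theta_L,\theta_R\rangle\bowtie|_D\theta$; (S$^3$) $\theta_1\bowtie\theta_1'$ and $\theta_2\bowtie\theta_2'$ $\Rightarrow\langle\theta_1,\theta_2\rangle\bowtie\langle\theta_1',\theta_2'\rangle$. *)

theory Defs
  imports "HOL-Library.Countable" "HOL-Library.Infinite_Typeclass"
begin

section \<open>Labels\<close>

datatype 'n vis = Name 'n | CoName 'n

fun co :: "'n vis \<Rightarrow> 'n vis" where
  "co (Name a) = CoName a"
| "co (CoName a) = Name a"

datatype 'n label = Vis "'n vis" | Tau

fun vis_name :: "'n vis \<Rightarrow> 'n" where
  "vis_name (Name a) = a"
| "vis_name (CoName a) = a"

fun label_names :: "'n label \<Rightarrow> 'n set" where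
  "label_names (Vis l) = {vis_name l}"
| "label_names Tau = {}"

section \<open>Processes up to \<open>\<alpha>\<close>-equivalence\<close>

datatype ('n, 'k) raw =
    RNil
  | RPref "'n label" "('n, 'k) raw"
  | RKPref "'n label" 'k "('n, 'k) raw"
  | RSum "('n, 'k) raw" "('n, 'k) raw"
  | RPar "('n, 'k) raw" "('n, 'k) raw"
  | RRes "('n, 'k) raw" 'n

fun raw_keys :: "('n, 'k) raw \<Rightarrow> 'k set" where
  "raw_keys RNil = {}"
| "raw_keys (RPref \<alpha> X) = raw_keys X"
| "raw_keys (RKPref \<alpha> k X) = insert k (raw_keys X)"
| "raw_keys (RSum X Y) = raw_keys X \<union> raw_keys Y"
| "raw_keys (RPar X Y) = raw_keys X \<union> raw_keys Y"
| "raw_keys (RRes X a) = raw_keys X"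

fun raw_fn :: "('n, 'k) raw \<Rightarrow> 'n set" where
  "raw_fn RNil = {}"
| "raw_fn (RPref \<alpha> X) = label_names \<alpha> \<union> raw_fn X"
| "raw_fn (RKPref \<alpha> k X) = label_names \<alpha> \<union> raw_fn X"
| "raw_fn (RSum X Y) = raw_fn X \<union> raw_fn Y"
| "raw_fn (RPar X Y) = raw_fn X \<union> raw_fn Y"
| "raw_fn (RRes X a) = raw_fn X - {a}"

definition swap_name :: "'n \<Rightarrow> 'n \<Rightarrow> 'n \<Rightarrow> 'n" where
  "swap_name a b c = (if c = a then b else if c = b then a else c)"

text \<open>Exchange of \<open>a\<close> and \<open>b\<close> everywhere, binding positions included.\<close>

fun raw_swap :: "'n \<Rightarrow> 'n \<Rightarrow> ('n, 'k) raw \<Rightarrow> ('n, 'k) raw" where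
  "raw_swap a b RNil = RNil"
| "raw_swap a b (RPref \<alpha> X) = RPref (map_label (swap_name a b) \<alpha>) (raw_swap a b X)"
| "raw_swap a b (RKPref \<alpha> k X) = RKPref (map_label (swap_name a b) \<alpha>) k (raw_swap a b X)"
| "raw_swap a b (RSum X Y) = RSum (raw_swap a b X) (raw_swap a b Y)"
| "raw_swap a b (RPar X Y) = RPar (raw_swap a b X) (raw_swap a b Y)"
| "raw_swap a b (RRes X c) = RRes (raw_swap a b X) (swap_name a b c)"

text \<open>
  For \<open>b\<close> not free in \<open>X\<close>, the swapping in rule \<open>conv\<close> agrees, up to \<open>\<alpha>\<close>-equivalence,
  with the capture-avoiding renaming of \<open>a\<close> to \<open>b\<close> in \<open>X\<close>.
\<close>

inductive raw_alpha :: "('n, 'k) raw \<Rightarrow> ('n, 'k) raw \<Rightarrow> bool" where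
  refl: "raw_alpha X X"
| sym: "raw_alpha X Y \<Longrightarrow> raw_alpha Y X"
| trans: "raw_alpha X Y \<Longrightarrow> raw_alpha Y Z \<Longrightarrow> raw_alpha X Z"
| pref: "raw_alpha X X' \<Longrightarrow> raw_alpha (RPref \<alpha> X) (RPref \<alpha> X')"
| kpref: "raw_alpha X X' \<Longrightarrow> raw_alpha (RKPref \<alpha> k X) (RKPref \<alpha> k X')"
| sum: "raw_alpha X X' \<Longrightarrow> raw_alpha Y Y' \<Longrightarrow> raw_alpha (RSum X Y) (RSum X' Y')"
| par: "raw_alpha X X' \<Longrightarrow> raw_alpha Y Y' \<Longrightarrow> raw_alpha (RPar X Y) (RPar X' Y')"
| res: "raw_alpha X X' \<Longrightarrow> raw_alpha (RRes X a) (RRes X' a)"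
| conv: "b \<notin> raw_fn X \<Longrightarrow> raw_alpha (RRes X a) (RRes (raw_swap a b X) b)"

lemma raw_keys_swap: "raw_keys (raw_swap a b X) = raw_keys X"
  by (induction X) auto

lemma raw_keys_alpha: "raw_alpha X Y \<Longrightarrow> raw_keys X = raw_keys Y"
  by (induction rule: raw_alpha.induct) (auto simp: raw_keys_swap)

quotient_type ('n, 'k) proc = "('n, 'k) raw" / raw_alpha
  by (intro equivpI reflpI sympI transpI) (blast intro: raw_alpha.intros)+

lift_definition Zero :: "('n, 'k) proc" is RNil .

lift_definition Pref :: "'n label \<Rightarrow> ('n, 'k) proc \<Rightarrow> ('n, 'k) proc" is RPref
  by (rule raw_alpha.pref)

lift_definition KPref :: "'n label \<Rightarrow> 'k \<Rightarrow> ('n, 'k) proc \<Rightarrow> ('n, 'k) proc" is RKPref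
  by (rule raw_alpha.kpref)

lift_definition Sum :: "('n, 'k) proc \<Rightarrow> ('n, 'k) proc \<Rightarrow> ('n, 'k) proc" is RSum
  by (rule raw_alpha.sum)

lift_definition Par :: "('n, 'k) proc \<Rightarrow> ('n, 'k) proc \<Rightarrow> ('n, 'k) proc" is RPar
  by (rule raw_alpha.par)

lift_definition Res :: "('n, 'k) proc \<Rightarrow> 'n \<Rightarrow> ('n, 'k) proc" is RRes
  by (rule raw_alpha.res)

lift_definition keys :: "('n, 'k) proc \<Rightarrow> 'k set" is raw_keys
  by (rule raw_keys_alpha)

definition std :: "('n, 'k) proc \<Rightarrow> bool" where
  "std X \<longleftrightarrow> keys X = {}"

section \<open>Proof keyed labels\<close>

datatype dir = L | R

fun opp :: "dir \<Rightarrow> dir" where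
  "opp L = R"
| "opp R = L"

datatype symb = SPar dir | SSum dir

text \<open>
  \<open>Single v \<alpha> k\<close> is \<open>v \<alpha>[k]\<close>, and \<open>Sync v v1 l v2 k\<close> is \<open>v \<langle>v1 l[k], v2 (co l)[k]\<rangle>\<close>;
  the matching of actions and keys in a synchronisation is thus built in.
\<close>

datatype ('n, 'k) plabel =
    Single "symb list" "'n label" 'k
  | Sync "symb list" "symb list" "'n vis" "symb list" 'k

fun prefix :: "symb \<Rightarrow> ('n, 'k) plabel \<Rightarrow> ('n, 'k) plabel" where
  "prefix s (Single v \<alpha> k) = Single (s # v) \<alpha> k"
| "prefix s (Sync v v1 l v2 k) = Sync (s # v) v1 l v2 k"

fun lab :: "('n, 'k) plabel \<Rightarrow> 'n label" where
  "lab (Single v \<alpha> k) = \<alpha>"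
| "lab (Sync v v1 l v2 k) = Tau"

fun key :: "('n, 'k) plabel \<Rightarrow> 'k" where
  "key (Single v \<alpha> k) = k"
| "key (Sync v v1 l v2 k) = k"

section \<open>Transitions\<close>

inductive fwd :: "('n, 'k) proc \<Rightarrow> ('n, 'k) plabel \<Rightarrow> ('n, 'k) proc \<Rightarrow> bool" where
  pref: "std X \<Longrightarrow> fwd (Pref \<alpha> X) (Single [] \<alpha> k) (KPref \<alpha> k X)"
| kpref: "fwd X \<theta> X' \<Longrightarrow> key \<theta> \<noteq> k \<Longrightarrow> fwd (KPref \<alpha> k X) \<theta> (KPref \<alpha> k X')"
| sumL: "fwd X \<theta> X' \<Longrightarrow> std Y \<Longrightarrow> fwd (Sum X Y) (prefix (SSum L) \<theta>) (Sum X' Y)"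
| sumR: "fwd Y \<theta> Y' \<Longrightarrow> std X \<Longrightarrow> fwd (Sum X Y) (prefix (SSum R) \<theta>) (Sum X Y')"
| parL: "fwd X \<theta> X' \<Longrightarrow> key \<theta> \<notin> keys Y \<Longrightarrow> fwd (Par X Y) (prefix (SPar L) \<theta>) (Par X' Y)"
| parR: "fwd Y \<theta> Y' \<Longrightarrow> key \<theta> \<notin> keys X \<Longrightarrow> fwd (Par X Y) (prefix (SPar R) \<theta>) (Par X Y')"
| syn: "fwd X (Single v1 (Vis l) k) X' \<Longrightarrow> fwd Y (Single v2 (Vis (co l)) k) Y' \<Longrightarrow>
    fwd (Par X Y) (Sync [] v1 l v2 k) (Par X' Y')"
| nu: "fwd X \<theta> X' \<Longrightarrow> lab \<theta> \<notin> {Vis (Name a), Vis (CoName a)} \<Longrightarrow>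
    fwd (Res X a) \<theta> (Res X' a)"

inductive bwd :: "('n, 'k) proc \<Rightarrow> ('n, 'k) plabel \<Rightarrow> ('n, 'k) proc \<Rightarrow> bool" where
  pref: "std X \<Longrightarrow> bwd (KPref \<alpha> k X) (Single [] \<alpha> k) (Pref \<alpha> X)"
| kpref: "bwd X' \<theta> X \<Longrightarrow> key \<theta> \<noteq> k \<Longrightarrow> bwd (KPref \<alpha> k X') \<theta> (KPref \<alpha> k X)"
| sumL: "bwd X' \<theta> X \<Longrightarrow> std Y \<Longrightarrow> bwd (Sum X' Y) (prefix (SSum L) \<theta>) (Sum X Y)"
| sumR: "bwd Y' \<theta> Y \<Longrightarrow> std X \<Longrightarrow> bwd (Sum X Y') (prefix (SSum R) \<theta>) (Sum X Y)"
| parL: "bwd X' \<theta> X \<Longrightarrow> key \<theta> \<notin> keys Y \<Longrightarrow> bwd (Par X' Y) (prefix (SPar L) \<theta>) (Par X Y)"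
| parR: "bwd Y' \<theta> Y \<Longrightarrow> key \<theta> \<notin> keys X \<Longrightarrow> bwd (Par X Y') (prefix (SPar R) \<theta>) (Par X Y)"
| syn: "bwd X' (Single v1 (Vis l) k) X \<Longrightarrow> bwd Y' (Single v2 (Vis (co l)) k) Y \<Longrightarrow>
    bwd (Par X' Y') (Sync [] v1 l v2 k) (Par X Y)"
| nu: "bwd X' \<theta> X \<Longrightarrow> lab \<theta> \<notin> {Vis (Name a), Vis (CoName a)} \<Longrightarrow>
    bwd (Res X' a) \<theta> (Res X a)"

definition step :: "('n, 'k) proc \<Rightarrow> ('n, 'k) plabel \<Rightarrow> ('n, 'k) proc \<Rightarrow> bool" where
  "step X \<theta> Y \<longleftrightarrow> fwd X \<theta> Y \<or> bwd X \<theta> Y"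

definition has_path :: "('n, 'k) proc \<Rightarrow> ('n, 'k) proc \<Rightarrow> bool" where
  "has_path = (\<lambda>X Y. \<exists>\<theta>. step X \<theta> Y)\<^sup>*\<^sup>*"

definition reachable :: "('n, 'k) proc \<Rightarrow> bool" where
  "reachable X \<longleftrightarrow> (\<exists>Y. std Y \<and> has_path Y X)"

type_synonym ('n, 'k) transition = "('n, 'k) proc \<times> ('n, 'k) plabel \<times> ('n, 'k) proc"

definition connected_trans :: "('n, 'k) transition \<Rightarrow> ('n, 'k) transition \<Rightarrow> bool" where
  "connected_trans t1 t2 \<longleftrightarrow> has_path (fst t1) (fst t2)"

section \<open>Connectivity of proof keyed labels\<close>

fun component :: "dir \<Rightarrow> symb list \<Rightarrow> 'n vis \<Rightarrow> symb list \<Rightarrow> 'k \<Rightarrow> ('n, 'k) plabel" where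
  "component L v1 l v2 k = Single v1 (Vis l) k"
| "component R v1 l v2 k = Single v2 (Vis (co l)) k"

inductive conn :: "('n, 'k) plabel \<Rightarrow> ('n, 'k) plabel \<Rightarrow> bool" (infix \<open>\<bowtie>\<close> 50) where
  A1: "Single [] \<alpha> k \<bowtie> \<theta>"
| A2: "\<theta> \<bowtie> Single [] \<alpha> k"
| P1: "\<theta>1 \<bowtie> \<theta>2 \<Longrightarrow> prefix (SPar D) \<theta>1 \<bowtie> prefix (SPar D) \<theta>2"
| P2: "prefix (SPar D) \<theta>1 \<bowtie> prefix (SPar (opp D)) \<theta>2"
| C1: "\<theta>1 \<bowtie> \<theta>2 \<Longrightarrow> prefix (SSum D) \<theta>1 \<bowtie> prefix (SSum D) \<theta>2"
| C2: "prefix (SSum D) \<theta>1 \<bowtie> prefix (SSum (opp D)) \<theta>2"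
| S1: "\<theta> \<bowtie> component D v1 l v2 k \<Longrightarrow> prefix (SPar D) \<theta> \<bowtie> Sync [] v1 l v2 k"
| S2: "component D v1 l v2 k \<bowtie> \<theta> \<Longrightarrow> Sync [] v1 l v2 k \<bowtie> prefix (SPar D) \<theta>"
| S3: "component L v1 l v2 k \<bowtie> component L v1' l' v2' k' \<Longrightarrow>
    component R v1 l v2 k \<bowtie> component R v1' l' v2' k' \<Longrightarrow>
    Sync [] v1 l v2 k \<bowtie> Sync [] v1' l' v2' k'"

end

theory Submission
  imports Defs
begin

text \<open>
  For the first part, forget keys, actions and restrictions. The tree that remains does not change
  along transitions, and it bounds the labels a process can perform; any two labels admitted by the
  same tree are connected.

  For the second part, connected labels are realised by forward transitions of two processes that
  are both reached by forward paths from one standard process; reversing one of these paths joins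
  the two. The only obstacle is the rule for two synchronisations, where the paths of the two
  components are run in parallel and their keys must not clash. Therefore the induction produces
  realisations whose paths avoid any given finite set of keys.
\<close>

section \<open>Shapes of processes\<close>

text \<open>Plain and keyed prefixes will share \<open>Act\<close>, since executing a prefix only
  turns one into the other; restriction leaves no trace.\<close>

datatype shape = Leaf | Act shape | Choice shape shape | Parallel shape shape

fun raw_shape :: "('n, 'k) raw \<Rightarrow> shape" where
  "raw_shape RNil = Leaf"
| "raw_shape (RPref \<alpha> X) = Act (raw_shape X)"
| "raw_shape (RKPref \<alpha> k X) = Act (raw_shape X)"
| "raw_shape (RSum X Y) = Choice (raw_shape X) (raw_shape Y)"
| "raw_shape (RPar X Y) = Parallel (raw_shape X) (raw_shape Y)"
| "raw_shape (RRes X a) = raw_shape X"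

lemma raw_shape_swap: "raw_shape (raw_swap a b X) = raw_shape X"
  by (induction X) auto

lemma raw_shape_alpha: "raw_alpha X Y \<Longrightarrow> raw_shape X = raw_shape Y"
  by (induction rule: raw_alpha.induct) (auto simp: raw_shape_swap)

lift_definition shape :: "('n, 'k) proc \<Rightarrow> shape" is raw_shape
  by (rule raw_shape_alpha)

lemma shape_simps [simp]:
  "shape Zero = Leaf"
  "shape (Pref \<alpha> X) = Act (shape X)"
  "shape (KPref \<alpha> k X) = Act (shape X)"
  "shape (Sum X Y) = Choice (shape X) (shape Y)"
  "shape (Par X Y) = Parallel (shape X) (shape Y)"
  "shape (Res X a) = shape X"
  by (transfer; simp)+

text \<open>An upper bound on what a process of the shape can perform: side conditions on keys,
  standardness and restricted names are dropped. As \<open>Act\<close> does not record whether its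
  prefix has been executed, both \<open>act\<close> and \<open>under\<close> apply to it.\<close>

inductive admits :: "shape \<Rightarrow> ('n, 'k) plabel \<Rightarrow> bool" where
  act: "admits (Act s) (Single [] \<alpha> k)"
| under: "admits s \<theta> \<Longrightarrow> admits (Act s) \<theta>"
| choiceL: "admits s \<theta> \<Longrightarrow> admits (Choice s t) (prefix (SSum L) \<theta>)"
| choiceR: "admits t \<theta> \<Longrightarrow> admits (Choice s t) (prefix (SSum R) \<theta>)"
| parL: "admits s \<theta> \<Longrightarrow> admits (Parallel s t) (prefix (SPar L) \<theta>)"
| parR: "admits t \<theta> \<Longrightarrow> admits (Parallel s t) (prefix (SPar R) \<theta>)"
| syn: "admits s (Single v1 (Vis l) k) \<Longrightarrow> admits t (Single v2 (Vis (co l)) k) \<Longrightarrow>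
    admits (Parallel s t) (Sync [] v1 l v2 k)"

inductive_cases admits_ActE: "admits (Act s) \<theta>"
inductive_cases admits_ChoiceE: "admits (Choice s t) \<theta>"
inductive_cases admits_ParallelE: "admits (Parallel s t) \<theta>"

lemma fwd_shape: "fwd X \<theta> Y \<Longrightarrow> shape Y = shape X \<and> admits (shape X) \<theta>"
  by (induction rule: fwd.induct) (auto intro: admits.intros)

lemma bwd_shape: "bwd X \<theta> Y \<Longrightarrow> shape Y = shape X \<and> admits (shape X) \<theta>"
  by (induction rule: bwd.induct) (auto intro: admits.intros)

lemma step_shape: "step X \<theta> Y \<Longrightarrow> shape Y = shape X"
  and step_admits: "step X \<theta> Y \<Longrightarrow> admits (shape X) \<theta>"
  by (auto simp: step_def dest: fwd_shape bwd_shape)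

lemma has_path_shape: "has_path X Y \<Longrightarrow> shape Y = shape X"
  unfolding has_path_def by (induction rule: rtranclp_induct) (auto dest: step_shape)

lemma conn_par_opposite:
  "prefix (SPar L) \<theta>1 \<bowtie> prefix (SPar R) \<theta>2"
  "prefix (SPar R) \<theta>1 \<bowtie> prefix (SPar L) \<theta>2"
  using conn.P2[of L] conn.P2[of R] by simp_all

lemma conn_sum_opposite:
  "prefix (SSum L) \<theta>1 \<bowtie> prefix (SSum R) \<theta>2"
  "prefix (SSum R) \<theta>1 \<bowtie> prefix (SSum L) \<theta>2"
  using conn.C2[of L] conn.C2[of R] by simp_all

lemma conn_par_sync:
  "\<theta> \<bowtie> Single v1 (Vis l) k \<Longrightarrow> prefix (SPar L) \<theta> \<bowtie> Sync [] v1 l v2 k"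
  "\<theta> \<bowtie> Single v2 (Vis (co l)) k \<Longrightarrow> prefix (SPar R) \<theta> \<bowtie> Sync [] v1 l v2 k"
  "Single v1 (Vis l) k \<bowtie> \<theta> \<Longrightarrow> Sync [] v1 l v2 k \<bowtie> prefix (SPar L) \<theta>"
  "Single v2 (Vis (co l)) k \<bowtie> \<theta> \<Longrightarrow> Sync [] v1 l v2 k \<bowtie> prefix (SPar R) \<theta>"
  using conn.S1[of \<theta> L] conn.S1[of \<theta> R] conn.S2[of L _ _ _ _ \<theta>] conn.S2[of R _ _ _ _ \<theta>]
  by simp_all

text \<open>Inverting the second derivation at the same shape pairs the last rules, and each pair
  matches a rule of connectivity: \<open>act\<close> gives \<open>A1\<close> or \<open>A2\<close>,
  equal sides \<open>P1\<close> or \<open>C1\<close>, opposite sides \<open>P2\<close> or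
  \<open>C2\<close>, one side against \<open>syn\<close> gives \<open>S1\<close> or
  \<open>S2\<close>, two \<open>syn\<close> give \<open>S3\<close>.\<close>

lemma admits_conn: "admits s \<theta>1 \<Longrightarrow> admits s \<theta>2 \<Longrightarrow> \<theta>1 \<bowtie> \<theta>2"
proof (induction arbitrary: \<theta>2 rule: admits.induct)
  case act
  show ?case by (rule conn.A1)
next
  case under
  from under.prems show ?case
    by (rule admits_ActE) (auto intro: under.IH conn.A2)
next
  case choiceL
  from choiceL.prems show ?case
    by (rule admits_ChoiceE) (auto intro: choiceL.IH conn.C1 conn_sum_opposite)
next
  case choiceR
  from choiceR.prems show ?case
    by (rule admits_ChoiceE) (auto intro: choiceR.IH conn.C1 conn_sum_opposite)
next
  case parL
  from parL.prems show ?case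
    by (rule admits_ParallelE) (auto intro: parL.IH conn.P1 conn_par_opposite conn_par_sync)
next
  case parR
  from parR.prems show ?case
    by (rule admits_ParallelE) (auto intro: parR.IH conn.P1 conn_par_opposite conn_par_sync)
next
  case syn
  from syn.prems show ?case
    by (rule admits_ParallelE) (auto intro!: syn.IH conn.S3 conn_par_sync)
qed

lemma connected_steps_conn:
  assumes "step X1 \<theta>1 X1'" "step X2 \<theta>2 X2'" "has_path X1 X2"
  shows "\<theta>1 \<bowtie> \<theta>2"
  using assms by (metis admits_conn has_path_shape step_admits)

section \<open>Realising connected labels\<close>

lemma keys_simps [simp]:
  "keys Zero = {}"
  "keys (Pref \<alpha> X) = keys X"
  "keys (KPref \<alpha> k X) = insert k (keys X)"
  "keys (Sum X Y) = keys X \<union> keys Y"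
  "keys (Par X Y) = keys X \<union> keys Y"
  "keys (Res X a) = keys X"
  by (transfer; simp)+

lemma std_simps [simp]:
  "std Zero"
  "std (Pref \<alpha> X) \<longleftrightarrow> std X"
  "std (Sum X Y) \<longleftrightarrow> std X \<and> std Y"
  "std (Par X Y) \<longleftrightarrow> std X \<and> std Y"
  by (auto simp: std_def)

lemma key_prefix [simp]: "key (prefix s \<theta>) = key \<theta>"
  by (cases \<theta>) auto

section \<open>Forward paths, their keys and their reversal\<close>

lemma fwd_keys: "fwd X \<theta> Y \<Longrightarrow> keys Y = insert (key \<theta>) (keys X)"
  by (induction rule: fwd.induct) auto

lemma fwd_imp_bwd: "fwd X \<theta> Y \<Longrightarrow> bwd Y \<theta> X"
  by (induction rule: fwd.induct) (auto intro: bwd.intros)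

definition fpath :: "'k set \<Rightarrow> ('n, 'k) proc \<Rightarrow> ('n, 'k) proc \<Rightarrow> bool" where
  "fpath K = (\<lambda>X Y. \<exists>\<theta>. fwd X \<theta> Y \<and> key \<theta> \<in> K)\<^sup>*\<^sup>*"

lemma fpath_refl [simp]: "fpath K X X"
  by (simp add: fpath_def)

lemma fpath_trans: "fpath K X Y \<Longrightarrow> fpath K Y Z \<Longrightarrow> fpath K X Z"
  unfolding fpath_def by (rule rtranclp_trans)

lemma fpath_step: "fwd X \<theta> Y \<Longrightarrow> key \<theta> \<in> K \<Longrightarrow> fpath K X Y"
  by (auto simp: fpath_def)

lemma fpath_mono: "fpath K X Y \<Longrightarrow> K \<subseteq> K' \<Longrightarrow> fpath K' X Y"
  unfolding fpath_def by (erule rtranclp_mono[THEN predicate2D, rotated]) blast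

lemma fpath_keys: "fpath K X Y \<Longrightarrow> keys Y \<subseteq> keys X \<union> K"
  unfolding fpath_def by (induction rule: rtranclp_induct) (auto simp: fwd_keys)

text \<open>\<open>C\<close> stands for a one-hole context; the label of a lifted step may gain a
  symbol as long as its key stays in \<open>K\<close>.\<close>

lemma fpath_context:
  assumes "fpath K X Y"
    and "\<And>U \<theta> V. fwd U \<theta> V \<Longrightarrow> key \<theta> \<in> K \<Longrightarrow> \<exists>\<theta>'. fwd (C U) \<theta>' (C V) \<and> key \<theta>' \<in> K"
  shows "fpath K (C X) (C Y)"
  using assms(1) unfolding fpath_def
  by (induction rule: rtranclp_induct) (auto intro: rtranclp.rtrancl_into_rtrancl dest: assms(2))

lemma fpath_sumL: "fpath K X Y \<Longrightarrow> std Z \<Longrightarrow> fpath K (Sum X Z) (Sum Y Z)"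
  by (erule fpath_context) (metis fwd.sumL key_prefix)

lemma fpath_sumR: "fpath K X Y \<Longrightarrow> std Z \<Longrightarrow> fpath K (Sum Z X) (Sum Z Y)"
  by (erule fpath_context) (metis fwd.sumR key_prefix)

lemma fpath_parL: "fpath K X Y \<Longrightarrow> keys Z \<inter> K = {} \<Longrightarrow> fpath K (Par X Z) (Par Y Z)"
  by (erule fpath_context) (metis disjoint_iff fwd.parL key_prefix)

lemma fpath_parR: "fpath K X Y \<Longrightarrow> keys Z \<inter> K = {} \<Longrightarrow> fpath K (Par Z X) (Par Z Y)"
  by (erule fpath_context) (metis disjoint_iff fwd.parR key_prefix)

text \<open>The left component runs first, beside the keyless \<open>Q\<close>; the right one then
  runs beside \<open>X\<close>, whose keys lie in \<open>K1\<close> and so miss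
  \<open>K2\<close>.\<close>

lemma fpath_par:
  assumes "fpath K1 P X" "fpath K2 Q Y" "std P" "std Q" "K1 \<inter> K2 = {}"
  shows "fpath (K1 \<union> K2) (Par P Q) (Par X Y)"
proof (rule fpath_trans)
  show "fpath (K1 \<union> K2) (Par P Q) (Par X Q)"
    using assms by (intro fpath_mono[OF fpath_parL, of K1]) (auto simp: std_def)
  have "keys X \<subseteq> K1"
    using fpath_keys[OF assms(1)] assms(3) by (auto simp: std_def)
  then show "fpath (K1 \<union> K2) (Par X Q) (Par X Y)"
    using assms by (intro fpath_mono[OF fpath_parR, of K2]) auto
qed

lemma fpath_imp_has_path: "fpath K X Y \<Longrightarrow> has_path X Y"
  unfolding fpath_def has_path_def
  by (erule rtranclp_mono[THEN predicate2D, rotated]) (auto simp: step_def)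

lemma fpath_imp_has_path_back: "fpath K X Y \<Longrightarrow> has_path Y X"
  unfolding fpath_def has_path_def
  by (induction rule: rtranclp_induct)
    (auto intro: converse_rtranclp_into_rtranclp simp: step_def dest!: fwd_imp_bwd)

section \<open>Processes realising a given label or pair of labels\<close>

lemma ex_std_fwd:
  fixes \<theta> :: "('n, 'k) plabel"
  shows "\<exists>P P'. std P \<and> fwd P \<theta> P'"
proof -
  \<comment> \<open>Each symbol of the string becomes a parallel composition or a sum with
    \<open>Zero\<close>, which is keyless and standard, so all side conditions hold.\<close>
  have prefixed: "\<exists>P P'. std P \<and> fwd P (prefix s \<theta>) P'"
    if "std P" "fwd P \<theta> P'" for s P P' and \<theta> :: "('n, 'k) plabel"
  proof -
    obtain D where "s = SPar D \<or> s = SSum D"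
      by (cases s) auto
    then show ?thesis
      using that fwd.parL[of P \<theta> P' Zero] fwd.parR[of P \<theta> P' Zero]
        fwd.sumL[of P \<theta> P' Zero] fwd.sumR[of P \<theta> P' Zero]
      by (cases D) (metis keys_simps(1) empty_iff std_simps(1,3,4))+
  qed
  have single: "\<exists>P P'. std P \<and> fwd P (Single v \<alpha> k) P'" for v and \<alpha> :: "'n label" and k :: 'k
  proof (induction v)
    case Nil
    show ?case by (meson fwd.pref std_simps(1,2))
  next
    case (Cons s v)
    then show ?case using prefixed[of _ "Single v \<alpha> k" _ s] by auto
  qed
  have sync: "\<exists>P P'. std P \<and> fwd P (Sync v v1 l v2 k) P'"
    for v v1 v2 and l :: "'n vis" and k :: 'k
  proof (induction v)
    case Nil
    show ?case
      using single[of v1 "Vis l" k] single[of v2 "Vis (co l)" k] by (meson fwd.syn std_simps(4))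
  next
    case (Cons s v)
    then show ?case using prefixed[of _ "Sync v v1 l v2 k" _ s] by auto
  qed
  show ?thesis
    using single sync by (cases \<theta>) simp_all
qed

text \<open>Only the keys used on the two paths must avoid \<open>S\<close>; the keys of
  \<open>\<theta>1\<close> and \<open>\<theta>2\<close> are prescribed and may lie in it.\<close>

definition realised :: "'k set \<Rightarrow> ('n, 'k) plabel \<Rightarrow> ('n, 'k) plabel \<Rightarrow> bool" where
  "realised S \<theta>1 \<theta>2 \<longleftrightarrow> (\<exists>P K X1 X1' X2 X2'. std P \<and> finite K \<and> K \<inter> S = {} \<and>
     fpath K P X1 \<and> fwd X1 \<theta>1 X1' \<and> fpath K P X2 \<and> fwd X2 \<theta>2 X2')"

lemma realisedI:
  assumes "std P" "finite K" "K \<inter> S = {}"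
    "fpath K P X1" "fwd X1 \<theta>1 X1'" "fpath K P X2" "fwd X2 \<theta>2 X2'"
  shows "realised S \<theta>1 \<theta>2"
  using assms unfolding realised_def by blast

text \<open>Derives \<open>A2\<close> and \<open>S2\<close> from \<open>A1\<close> and
  \<open>S1\<close>, and one orientation of \<open>P2\<close> and \<open>C2\<close> from the
  other.\<close>

lemma realised_sym: "realised S \<theta>1 \<theta>2 \<Longrightarrow> realised S \<theta>2 \<theta>1"
  unfolding realised_def by blast

text \<open>A prefix is put in front of a process performing \<open>\<theta>\<close>: it fires at
  once for the first label, and is executed beforehand for the second.\<close>

lemma realised_act:
  fixes \<theta> :: "('n, 'k::infinite) plabel"
  assumes "finite S"
  shows "realised S (Single [] \<alpha> k) \<theta>"
proof -
  obtain P P' where P: "std P" "fwd P \<theta> P'"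
    using ex_std_fwd by blast
  \<comment> \<open>The path uses a fresh key rather than \<open>k\<close>: \<open>k\<close> may lie
    in \<open>S\<close>, or equal \<open>key \<theta>\<close> and so block
    \<open>kpref\<close>.\<close>
  obtain m where m: "m \<notin> insert (key \<theta>) S"
    using ex_new_if_finite[of "insert (key \<theta>) S"] assms infinite_UNIV by auto
  show ?thesis
  proof (rule realisedI)
    show "std (Pref \<alpha> P)" using P by simp
    show "finite {m}" "{m} \<inter> S = {}" using m by auto
    show "fpath {m} (Pref \<alpha> P) (Pref \<alpha> P)" by simp
    show "fwd (Pref \<alpha> P) (Single [] \<alpha> k) (KPref \<alpha> k P)" using P by (intro fwd.pref)
    show "fpath {m} (Pref \<alpha> P) (KPref \<alpha> m P)"
      using P by (intro fpath_step[OF fwd.pref]) auto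
    show "fwd (KPref \<alpha> m P) \<theta> (KPref \<alpha> m P')" using P m by (intro fwd.kpref) auto
  qed
qed

lemma realised_par:
  assumes "realised S \<theta>1 \<theta>2"
  shows "realised S (prefix (SPar D) \<theta>1) (prefix (SPar D) \<theta>2)"
proof -
  obtain P K X1 X1' X2 X2' where *: "std P" "finite K" "K \<inter> S = {}"
    "fpath K P X1" "fwd X1 \<theta>1 X1'" "fpath K P X2" "fwd X2 \<theta>2 X2'"
    using assms unfolding realised_def by blast
  show ?thesis
  proof (cases D)
    case L
    show ?thesis unfolding L
      by (rule realisedI[of "Par P Zero" K S "Par X1 Zero" _ _ "Par X2 Zero"])
        (use * in \<open>auto intro: fpath_parL fwd.parL\<close>)
  next
    case R
    show ?thesis unfolding R
      by (rule realisedI[of "Par Zero P" K S "Par Zero X1" _ _ "Par Zero X2"])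
        (use * in \<open>auto intro: fpath_parR fwd.parR\<close>)
  qed
qed

lemma realised_sum:
  assumes "realised S \<theta>1 \<theta>2"
  shows "realised S (prefix (SSum D) \<theta>1) (prefix (SSum D) \<theta>2)"
proof -
  obtain P K X1 X1' X2 X2' where *: "std P" "finite K" "K \<inter> S = {}"
    "fpath K P X1" "fwd X1 \<theta>1 X1'" "fpath K P X2" "fwd X2 \<theta>2 X2'"
    using assms unfolding realised_def by blast
  show ?thesis
  proof (cases D)
    case L
    show ?thesis unfolding L
      by (rule realisedI[of "Sum P Zero" K S "Sum X1 Zero" _ _ "Sum X2 Zero"])
        (use * in \<open>auto intro: fpath_sumL fwd.sumL\<close>)
  next
    case R
    show ?thesis unfolding R
      by (rule realisedI[of "Sum Zero P" K S "Sum Zero X1" _ _ "Sum Zero X2"])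
        (use * in \<open>auto intro: fpath_sumR fwd.sumR\<close>)
  qed
qed

text \<open>Both labels are available in one standard process, one on each side, so the paths are
  empty.\<close>

lemma realised_par_opposite:
  fixes \<theta>1 :: "('n, 'k) plabel"
  shows "realised S (prefix (SPar D) \<theta>1) (prefix (SPar (opp D)) \<theta>2)"
proof -
  have LR: "realised S (prefix (SPar L) \<theta>1) (prefix (SPar R) \<theta>2)"
    for \<theta>1 \<theta>2 :: "('n, 'k) plabel"
  proof -
    obtain P P' Q Q' where "std P" "fwd P \<theta>1 P'" "std Q" "fwd Q \<theta>2 Q'"
      using ex_std_fwd by metis
    then show ?thesis
      by (intro realisedI[of "Par P Q" "{}" S "Par P Q" _ _ "Par P Q"])
        (auto intro: fwd.intros simp: std_def)
  qed
  then show ?thesis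
    by (cases D) (auto intro: realised_sym)
qed

lemma realised_sum_opposite:
  fixes \<theta>1 :: "('n, 'k) plabel"
  shows "realised S (prefix (SSum D) \<theta>1) (prefix (SSum (opp D)) \<theta>2)"
proof -
  have LR: "realised S (prefix (SSum L) \<theta>1) (prefix (SSum R) \<theta>2)"
    for \<theta>1 \<theta>2 :: "('n, 'k) plabel"
  proof -
    obtain P P' Q Q' where "std P" "fwd P \<theta>1 P'" "std Q" "fwd Q \<theta>2 Q'"
      using ex_std_fwd by metis
    then show ?thesis
      by (intro realisedI[of "Sum P Q" "{}" S "Sum P Q" _ _ "Sum P Q"])
        (auto intro: fwd.intros)
  qed
  then show ?thesis
    by (cases D) (auto intro: realised_sym)
qed

text \<open>The partner \<open>Q\<close> offers the complementary half and stays standard along both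
  paths, so it adds no key that could block a step.\<close>

lemma realised_par_sync:
  assumes "realised S \<theta> (component D v1 l v2 k)"
  shows "realised S (prefix (SPar D) \<theta>) (Sync [] v1 l v2 k)"
proof -
  obtain P K X1 X1' X2 X2' where *: "std P" "finite K" "K \<inter> S = {}"
    "fpath K P X1" "fwd X1 \<theta> X1'" "fpath K P X2" "fwd X2 (component D v1 l v2 k) X2'"
    using assms unfolding realised_def by blast
  obtain Q Q' where Q: "std Q" "fwd Q (component (opp D) v1 l v2 k) Q'"
    using ex_std_fwd by blast
  show ?thesis
  proof (cases D)
    case L
    show ?thesis unfolding L
      by (rule realisedI[of "Par P Q" K S "Par X1 Q" _ _ "Par X2 Q"])
        (use * Q L in \<open>auto intro: fpath_parL fwd.parL fwd.syn simp: std_def\<close>)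
  next
    case R
    show ?thesis unfolding R
      by (rule realisedI[of "Par Q P" K S "Par Q X1" _ _ "Par Q X2"])
        (use * Q R in \<open>auto intro: fpath_parR fwd.parR fwd.syn simp: std_def\<close>)
  qed
qed

text \<open>Both components need their own paths, so the hypotheses must hold for every finite set
  of keys to avoid, not just for \<open>S\<close>.\<close>

lemma realised_sync:
  assumes "finite S"
    and left: "\<And>S. finite S \<Longrightarrow> realised S (component L v1 l v2 k) (component L v1' l' v2' k')"
    and right: "\<And>S. finite S \<Longrightarrow> realised S (component R v1 l v2 k) (component R v1' l' v2' k')"
  shows "realised S (Sync [] v1 l v2 k) (Sync [] v1' l' v2' k')"
proof -
  obtain P K X1 X1' X2 X2' where P: "std P" "finite K" "K \<inter> S = {}"
    "fpath K P X1" "fwd X1 (component L v1 l v2 k) X1'"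
    "fpath K P X2" "fwd X2 (component L v1' l' v2' k') X2'"
    using left[OF \<open>finite S\<close>] unfolding realised_def by blast
  \<comment> \<open>Forbidding \<open>K\<close> as well on the right makes the keys of the two
    components disjoint, as \<open>fpath_par\<close> requires.\<close>
  have "finite (S \<union> K)"
    using P \<open>finite S\<close> by simp
  then obtain Q K' Y1 Y1' Y2 Y2' where Q: "std Q" "finite K'" "K' \<inter> (S \<union> K) = {}"
    "fpath K' Q Y1" "fwd Y1 (component R v1 l v2 k) Y1'"
    "fpath K' Q Y2" "fwd Y2 (component R v1' l' v2' k') Y2'"
    using right[of "S \<union> K"] unfolding realised_def by blast
  then have disjoint: "K \<inter> K' = {}"
    by blast
  show ?thesis
  proof (rule realisedI)
    show "std (Par P Q)" "finite (K \<union> K')" "(K \<union> K') \<inter> S = {}"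
      using P Q by auto
    show "fpath (K \<union> K') (Par P Q) (Par X1 Y1)" "fpath (K \<union> K') (Par P Q) (Par X2 Y2)"
      using P Q disjoint by (auto intro: fpath_par)
    show "fwd (Par X1 Y1) (Sync [] v1 l v2 k) (Par X1' Y1')"
      "fwd (Par X2 Y2) (Sync [] v1' l' v2' k') (Par X2' Y2')"
      using P Q by (auto intro: fwd.syn)
  qed
qed

text \<open>Rule induction with \<open>S\<close> generalised, as \<open>S3\<close> calls its second
  hypothesis with a larger set; infinitely many keys provide the fresh one in the axiom cases
  \<open>A1\<close> and \<open>A2\<close>.\<close>

lemma conn_realised:
  fixes \<theta>1 :: "('n, 'k::infinite) plabel"
  shows "\<theta>1 \<bowtie> \<theta>2 \<Longrightarrow> finite S \<Longrightarrow> realised S \<theta>1 \<theta>2"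
proof (induction arbitrary: S rule: conn.induct)
  case A1
  then show ?case by (rule realised_act)
next
  case A2
  then show ?case by (intro realised_sym[OF realised_act])
next
  case P1
  then show ?case by (intro realised_par)
next
  case P2
  show ?case by (rule realised_par_opposite)
next
  case C1
  then show ?case by (intro realised_sum)
next
  case C2
  show ?case by (rule realised_sum_opposite)
next
  case S1
  then show ?case by (intro realised_par_sync)
next
  case S2
  then show ?case by (intro realised_sym[OF realised_par_sync] realised_sym[OF S2.IH])
next
  case S3
  then show ?case by (intro realised_sync)
qed

lemma realised_imp_connected_steps:
  assumes "realised S \<theta>1 \<theta>2"
  shows "\<exists>X1 X1' X2 X2'. step X1 \<theta>1 X1' \<and> step X2 \<theta>2 X2' \<and> reachable X1 \<and> has_path X1 X2"
proof -
  obtain P K X1 X1' X2 X2' where *: "std P"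
    "fpath K P X1" "fwd X1 \<theta>1 X1'" "fpath K P X2" "fwd X2 \<theta>2 X2'"
    using assms unfolding realised_def by blast
  \<comment> \<open>Back to \<open>P\<close> along the reversed first path, then forward along the
    second.\<close>
  have "has_path X1 X2"
    using fpath_imp_has_path_back[OF *(2)] fpath_imp_has_path[OF *(4)]
    unfolding has_path_def by (rule rtranclp_trans)
  moreover have "reachable X1"
    using * fpath_imp_has_path unfolding reachable_def by blast
  ultimately show ?thesis
    using * unfolding step_def by blast
qed

theorem theorem1:
  shows "(\<forall>(X1 :: ('n::infinite, 'k::{countable,infinite}) proc) \<theta>1 X1' X2 \<theta>2 X2'.
            step X1 \<theta>1 X1' \<and> step X2 \<theta>2 X2' \<and>
            connected_trans (X1, \<theta>1, X1') (X2, \<theta>2, X2') \<and> reachable X1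
            \<longrightarrow> \<theta>1 \<bowtie> \<theta>2)
       \<and> (\<forall>(\<theta>1 :: ('n, 'k) plabel) \<theta>2. \<theta>1 \<bowtie> \<theta>2 \<longrightarrow>
            (\<exists>X1 X1' X2 X2'. step X1 \<theta>1 X1' \<and> step X2 \<theta>2 X2' \<and>
              reachable X1 \<and> connected_trans (X1, \<theta>1, X1') (X2, \<theta>2, X2')))"
  unfolding connected_trans_def fst_conv
  \<comment> \<open>At the top level no key has to be avoided, so \<open>S\<close> is empty.\<close>
  using connected_steps_conn realised_imp_connected_steps[OF conn_realised[OF _ finite.emptyI]]
  by blast

end
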